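(* Let $(X,\mu)$ and $(Y,\nu)$ be finite measure spaces, $f=(f_1,\dots,f_n)\in L^1(X,\mu,\mathbb{R}^n)$, $g=(g_1,\dots,g_n)\in L^1(Y,\nu,\mathbb{R}^n)$, $h\in L^1(X,\mu,(0,\infty))$, and $k\in L^1(Y,\nu,(0,\infty))$. Define the measures $\alpha$ on $X$ and $\beta$ on $Y$ by $\alpha=h\,d\mu$ and $\beta=k\,d\nu$. The following are equivalent: (1) $(f_1,\dots,f_n,h)$ is matrix majorized by $(g_1,\dots,g_n,k)$; i.e., there exists a stochastic operator $S:L^1(Y,\nu)\to L^1(X,\mu)$ such that $Sg_i=f_i$ for all $i=1,\dots,n$ and $Sk=h$. (2) $\left(\frac{f_1}{h},\dots,\frac{f_n}{h}\right)$ is multivariate majorized by $\left(\frac{g_1}{k},\dots,\frac{g_n}{k}\right)$ with respect to the measures $\alpha$ and $\beta$; i.e., there exists a doubly stochastic operator $D:L^1(Y,\beta)\to L^1(X,\alpha)$ such that $D\frac{g_i}{k}=\frac{f_i}{h}$ for all $i=1,\dots,n$.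
   Context: $L^1(X,\mu,\mathbb{R}^n)$ denotes the measurable functions $f:X\to\mathbb{R}^n$ with $\int_X\sum_{i=1}^n|f_i|\,d\mu<\infty$, and $L^1(X,\mu,(0,\infty))$ the integrable functions with values in $(0,\infty)$. For $\sigma$-finite measure spaces, a linear operator $S:L^1(Y,\nu)\to L^1(X,\mu)$ is a stochastic operator if it is positive (it maps nonnegative functions to nonnegative functions) and $\int_X Sf\,d\mu=\int_Y f\,d\nu$ for all $f\in L^1(Y,\nu)$. It is a doubly stochastic operator if, in addition, $\mu(X)=\nu(Y)<\infty$ and $S1=1$. (In (2), this definition is applied with the measures $\alpha$ on $X$ and $\beta$ on $Y$, so $\alpha(X)=\beta(Y)<\infty$ is part of the requirement that $D$ be doubly stochastic.) *)

theory Defs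
  imports "HOL-Analysis.Analysis"
begin

text \<open>
  The space \<open>L\<^sup>1\<close> over a measure \<open>M\<close> is represented by the functions satisfying
  \<^term>\<open>integrable M\<close>, with two of them identified when they agree almost everywhere.
  The next lemma confirms that for values in \<open>real ^ 'n\<close> Bochner integrability amounts to
  measurability together with finiteness of the integral of the sum of the absolute values
  of the components.
\<close>

lemma integrable_vec_iff_sum_abs:
  fixes f :: "'a \<Rightarrow> real ^ 'n"
  shows "integrable M f \<longleftrightarrow>
    f \<in> borel_measurable M \<and> (\<integral>\<^sup>+x. ennreal (\<Sum>i\<in>UNIV. \<bar>f x $ i\<bar>) \<partial>M) < \<infinity>"
proof
  assume f: "integrable M f"
  have "integrable M (\<lambda>x. f x $ i)" for i
    using f integrable_bounded_linear[OF bounded_linear_vec_nth] by blast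
  then have "integrable M (\<lambda>x. \<Sum>i\<in>UNIV. \<bar>f x $ i\<bar>)"
    by (intro Bochner_Integration.integrable_sum integrable_abs)
  then have "(\<integral>\<^sup>+x. ennreal (norm (\<Sum>i\<in>UNIV. \<bar>f x $ i\<bar>)) \<partial>M) < \<infinity>"
    by (simp only: integrable_iff_bounded)
  with f show "f \<in> borel_measurable M \<and> (\<integral>\<^sup>+x. ennreal (\<Sum>i\<in>UNIV. \<bar>f x $ i\<bar>) \<partial>M) < \<infinity>"
    by (simp add: sum_nonneg)
next
  assume f: "f \<in> borel_measurable M \<and> (\<integral>\<^sup>+x. ennreal (\<Sum>i\<in>UNIV. \<bar>f x $ i\<bar>) \<partial>M) < \<infinity>"
  have "(\<integral>\<^sup>+x. ennreal (norm (f x)) \<partial>M) \<le> (\<integral>\<^sup>+x. ennreal (\<Sum>i\<in>UNIV. \<bar>f x $ i\<bar>) \<partial>M)"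
    by (intro nn_integral_mono ennreal_leI norm_le_l1_cart)
  with f show "integrable M f"
    by (auto simp: integrable_iff_bounded)
qed

text \<open>
  A linear operator from \<open>L\<^sup>1\<close> over \<open>N\<close> to \<open>L\<^sup>1\<close> over \<open>M\<close>, acting on representatives: it has
  to be well defined on, and linear modulo, almost everywhere equality. Its values on
  functions that are not integrable are irrelevant.
\<close>

definition L1_linear_operator ::
  "'b measure \<Rightarrow> 'a measure \<Rightarrow> (('b \<Rightarrow> real) \<Rightarrow> ('a \<Rightarrow> real)) \<Rightarrow> bool" where
  "L1_linear_operator N M S \<longleftrightarrow>
     (\<forall>u. integrable N u \<longrightarrow> integrable M (S u)) \<and>
     (\<forall>u v. integrable N u \<longrightarrow> integrable N v \<longrightarrow> (AE y in N. u y = v y) \<longrightarrow>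
        (AE x in M. S u x = S v x)) \<and>
     (\<forall>u v. integrable N u \<longrightarrow> integrable N v \<longrightarrow>
        (AE x in M. S (\<lambda>y. u y + v y) x = S u x + S v x)) \<and>
     (\<forall>c u. integrable N u \<longrightarrow> (AE x in M. S (\<lambda>y. c * u y) x = c * S u x))"

definition stochastic_operator ::
  "'b measure \<Rightarrow> 'a measure \<Rightarrow> (('b \<Rightarrow> real) \<Rightarrow> ('a \<Rightarrow> real)) \<Rightarrow> bool" where
  "stochastic_operator N M S \<longleftrightarrow>
     L1_linear_operator N M S \<and>
     (\<forall>u. integrable N u \<longrightarrow> (AE y in N. 0 \<le> u y) \<longrightarrow> (AE x in M. 0 \<le> S u x)) \<and>
     (\<forall>u. integrable N u \<longrightarrow> (\<integral>x. S u x \<partial>M) = (\<integral>y. u y \<partial>N))"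

definition doubly_stochastic_operator ::
  "'b measure \<Rightarrow> 'a measure \<Rightarrow> (('b \<Rightarrow> real) \<Rightarrow> ('a \<Rightarrow> real)) \<Rightarrow> bool" where
  "doubly_stochastic_operator N M D \<longleftrightarrow>
     stochastic_operator N M D \<and>
     emeasure M (space M) = emeasure N (space N) \<and>
     emeasure N (space N) < \<infinity> \<and>
     (AE x in M. D (\<lambda>_. 1) x = 1)"

end

theory Submission
  imports Defs
begin

text \<open>
  For a strictly positive weight \<open>k\<close>, multiplication by \<open>k\<close> is an isomorphism from
  \<open>L\<^sup>1(k d\<nu>)\<close> onto \<open>L\<^sup>1(\<nu>)\<close> that preserves both positivity and the integral; likewise for
  \<open>h\<close> and \<open>\<mu>\<close>. Conjugating with these two isomorphisms therefore sends a stochastic operator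
  \<open>S\<close> from \<open>L\<^sup>1(\<nu>)\<close> to \<open>L\<^sup>1(\<mu>)\<close> to a stochastic operator \<open>D u = S (k u) / h\<close> from
  \<open>L\<^sup>1(\<beta>)\<close> to \<open>L\<^sup>1(\<alpha>)\<close> (lemma \<open>stochastic_operator_reweight\<close>). Under this correspondence
  \<open>S g\<^sub>i = f\<^sub>i\<close> says \<open>D (g\<^sub>i / k) = f\<^sub>i / h\<close>, and \<open>S k = h\<close> says \<open>D 1 = 1\<close>; the latter also
  forces \<open>\<alpha>\<close> and \<open>\<beta>\<close> to have the same total mass, since \<open>S\<close> preserves the integral of \<open>k\<close>.

  Since \<open>\<nu>\<close> is in turn the measure with density \<open>1 / k\<close> with respect to \<open>\<beta>\<close>, the way back from
  \<open>D\<close> to \<open>S\<close> is the same conjugation with the reciprocal weights.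
\<close>

lemma AE_density_pos:
  fixes w :: "'a \<Rightarrow> real"
  assumes "w \<in> borel_measurable M" and "\<And>x. x \<in> space M \<Longrightarrow> 0 < w x"
  shows "(AE x in density M w. P x) \<longleftrightarrow> (AE x in M. P x)"
proof -
  have "(AE x in density M w. P x) \<longleftrightarrow> (AE x in M. 0 < ennreal (w x) \<longrightarrow> P x)"
    using assms(1) by (simp add: AE_density)
  also have "\<dots> \<longleftrightarrow> (AE x in M. P x)"
    using assms(2) by (intro AE_cong) simp
  finally show ?thesis .
qed

text \<open>
  Either side could fail through lack of measurability alone; strict positivity of the weight
  rules out a difference there, because \<open>u\<close> is recovered from \<open>w u\<close> on dividing by \<open>w\<close>.
\<close>

lemma integrable_density_pos:
  fixes w u :: "'a \<Rightarrow> real"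
  assumes w: "w \<in> borel_measurable M" and pos: "\<And>x. x \<in> space M \<Longrightarrow> 0 < w x"
  shows "integrable (density M w) u \<longleftrightarrow> integrable M (\<lambda>x. w x * u x)"
proof (cases "u \<in> borel_measurable M")
  case True
  moreover have "AE x in M. 0 \<le> w x"
    using pos by (auto intro: less_imp_le)
  ultimately show ?thesis
    using w by (simp add: integrable_density)
next
  case False
  have "\<not> integrable M (\<lambda>x. w x * u x)"
  proof
    assume "integrable M (\<lambda>x. w x * u x)"
    then have "(\<lambda>x. w x * u x / w x) \<in> borel_measurable M"
      using w by measurable
    also have "?this \<longleftrightarrow> u \<in> borel_measurable M"
      using pos by (intro measurable_cong) (simp add: less_imp_neq[symmetric])
    finally show False
      using False by simp
  qed
  moreover have "\<not> integrable (density M w) u"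
    using False borel_measurable_integrable by force
  ultimately show ?thesis
    by simp
qed

lemma integral_density_pos:
  fixes w u :: "'a \<Rightarrow> real"
  assumes w: "w \<in> borel_measurable M" and pos: "\<And>x. x \<in> space M \<Longrightarrow> 0 < w x"
    and u: "integrable (density M w) u"
  shows "(\<integral>x. u x \<partial>density M w) = (\<integral>x. w x * u x \<partial>M)"
proof -
  have "u \<in> borel_measurable M"
    using borel_measurable_integrable[OF u] by simp
  moreover have "AE x in M. 0 \<le> w x"
    using pos by (auto intro: less_imp_le)
  ultimately show ?thesis
    using w by (simp add: integral_density)
qed

lemma density_density_inverse:
  fixes w :: "'a \<Rightarrow> real"
  assumes w: "w \<in> borel_measurable M" and pos: "\<And>x. x \<in> space M \<Longrightarrow> 0 < w x"
  shows "density (density M w) (\<lambda>x. inverse (w x)) = M"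
proof -
  have "density (density M w) (\<lambda>x. inverse (w x)) =
      density M (\<lambda>x. ennreal (w x) * ennreal (inverse (w x)))"
    using w by (intro density_density_eq) simp_all
  also have "\<dots> = density M (\<lambda>_. 1)"
  proof (intro density_cong AE_I2)
    show "ennreal (w x) * ennreal (inverse (w x)) = 1" if "x \<in> space M" for x
      using pos[OF that] by (simp flip: ennreal_mult'')
  qed (use w in simp_all)
  also have "\<dots> = M"
    by (rule density_1)
  finally show ?thesis .
qed

definition reweight ::
  "('b \<Rightarrow> real) \<Rightarrow> ('a \<Rightarrow> real) \<Rightarrow> (('b \<Rightarrow> real) \<Rightarrow> ('a \<Rightarrow> real)) \<Rightarrow> ('b \<Rightarrow> real) \<Rightarrow> 'a \<Rightarrow> real"
  where "reweight k h S u = (\<lambda>x. S (\<lambda>y. k y * u y) x / h x)"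

text \<open>
  Each clause of the definition for the reweighted operator at \<open>u\<close> is the corresponding clause
  for \<open>S\<close> at \<open>k u\<close>, because multiplication by the weights respects integrability, almost
  everywhere statements, signs and integrals.
\<close>

lemma stochastic_operator_reweight:
  assumes S: "stochastic_operator N M S"
    and k: "k \<in> borel_measurable N" "\<And>y. y \<in> space N \<Longrightarrow> 0 < k y"
    and h: "h \<in> borel_measurable M" "\<And>x. x \<in> space M \<Longrightarrow> 0 < h x"
  shows "stochastic_operator (density N k) (density M h) (reweight k h S)"
proof -
  have AE_N: "(AE y in density N k. P y) \<longleftrightarrow> (AE y in N. P y)" for P
    by (rule AE_density_pos[OF k])
  have AE_M: "(AE x in density M h. P x) \<longleftrightarrow> (AE x in M. P x)" for P
    by (rule AE_density_pos[OF h])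
  note int_N = integrable_density_pos[OF k] and int_M = integrable_density_pos[OF h]
  have S_int: "integrable M (S u)" if "integrable N u" for u
    using S that by (simp add: stochastic_operator_def L1_linear_operator_def)
  have R_int: "integrable (density M h) (reweight k h S u)"
    if "integrable (density N k) u" for u
  proof -
    have "integrable M (S (\<lambda>y. k y * u y))"
      using S_int that int_N by blast
    also have "?this \<longleftrightarrow> integrable M (\<lambda>x. h x * reweight k h S u x)"
      using h(2) by (intro Bochner_Integration.integrable_cong)
        (simp_all add: reweight_def less_imp_neq[symmetric])
    finally show ?thesis
      by (simp add: int_M)
  qed
  have R_cong: "AE x in density M h. reweight k h S u x = reweight k h S v x"
    if "integrable (density N k) u" "integrable (density N k) v"
      "AE y in density N k. u y = v y" for u v
  proof -
    have "AE y in N. k y * u y = k y * v y"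
      using that(3) unfolding AE_N by eventually_elim simp
    then have "AE x in M. S (\<lambda>y. k y * u y) x = S (\<lambda>y. k y * v y) x"
      using S that(1,2) by (simp add: stochastic_operator_def L1_linear_operator_def int_N)
    then show ?thesis
      unfolding AE_M by eventually_elim (simp add: reweight_def)
  qed
  have R_add: "AE x in density M h.
      reweight k h S (\<lambda>y. u y + v y) x = reweight k h S u x + reweight k h S v x"
    if "integrable (density N k) u" "integrable (density N k) v" for u v
  proof -
    have "AE x in M. S (\<lambda>y. k y * u y + k y * v y) x
        = S (\<lambda>y. k y * u y) x + S (\<lambda>y. k y * v y) x"
      using S that by (simp add: stochastic_operator_def L1_linear_operator_def int_N)
    then show ?thesis
      unfolding AE_M by eventually_elim (simp add: reweight_def distrib_left add_divide_distrib)
  qed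
  have R_scale: "AE x in density M h. reweight k h S (\<lambda>y. c * u y) x = c * reweight k h S u x"
    if "integrable (density N k) u" for c u
  proof -
    have "AE x in M. S (\<lambda>y. c * (k y * u y)) x = c * S (\<lambda>y. k y * u y) x"
      using S that by (simp add: stochastic_operator_def L1_linear_operator_def int_N)
    then show ?thesis
      unfolding AE_M by eventually_elim (simp add: reweight_def mult.left_commute)
  qed
  have R_pos: "AE x in density M h. 0 \<le> reweight k h S u x"
    if "integrable (density N k) u" "AE y in density N k. 0 \<le> u y" for u
  proof -
    have "AE y in N. 0 \<le> k y * u y"
      using that(2) AE_space unfolding AE_N
      by eventually_elim (simp add: k(2) less_imp_le)
    then have "AE x in M. 0 \<le> S (\<lambda>y. k y * u y) x"
      using S that(1) by (simp add: stochastic_operator_def int_N)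
    then show ?thesis
      using AE_space unfolding AE_M
      by eventually_elim (simp add: reweight_def h(2) less_imp_le)
  qed
  have R_integral: "(\<integral>x. reweight k h S u x \<partial>density M h) = (\<integral>y. u y \<partial>density N k)"
    if "integrable (density N k) u" for u
  proof -
    have "(\<integral>x. reweight k h S u x \<partial>density M h) = (\<integral>x. h x * reweight k h S u x \<partial>M)"
      by (rule integral_density_pos[OF h R_int[OF that]])
    also have "\<dots> = (\<integral>x. S (\<lambda>y. k y * u y) x \<partial>M)"
      using h(2) by (intro Bochner_Integration.integral_cong)
        (simp_all add: reweight_def less_imp_neq[symmetric])
    also have "\<dots> = (\<integral>y. k y * u y \<partial>N)"
      using S that by (simp add: stochastic_operator_def int_N)
    also have "\<dots> = (\<integral>y. u y \<partial>density N k)"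
      by (rule integral_density_pos[OF k that, symmetric])
    finally show ?thesis .
  qed
  show ?thesis
    unfolding stochastic_operator_def L1_linear_operator_def
    by (intro conjI allI impI R_int R_cong R_add R_scale R_pos R_integral)
qed

lemma stochastic_operator_cong_AE:
  assumes "stochastic_operator N M S" "integrable N u" "integrable N v" "AE y in N. u y = v y"
  shows "AE x in M. S u x = S v x"
  using assms by (simp add: stochastic_operator_def L1_linear_operator_def)

lemma emeasure_density_space:
  fixes w :: "'a \<Rightarrow> real"
  assumes "integrable M w" and "\<And>x. x \<in> space M \<Longrightarrow> 0 < w x"
  shows "emeasure (density M w) (space M) = ennreal (\<integral>x. w x \<partial>M)"
proof -
  have "emeasure (density M w) (space M) = (\<integral>\<^sup>+x. ennreal (w x) \<partial>M)"
    using assms(1) by (subst emeasure_density) (auto intro!: nn_integral_cong)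
  also have "\<dots> = ennreal (\<integral>x. w x \<partial>M)"
    using assms by (intro nn_integral_eq_integral) (auto intro: less_imp_le)
  finally show ?thesis .
qed

theorem theorem3p11:
  fixes \<mu> :: "'a measure" and \<nu> :: "'b measure"
    and f :: "'a \<Rightarrow> real ^ 'n" and g :: "'b \<Rightarrow> real ^ 'n"
    and h :: "'a \<Rightarrow> real" and k :: "'b \<Rightarrow> real"
    and \<alpha> :: "'a measure" and \<beta> :: "'b measure"
  assumes "finite_measure \<mu>" and "finite_measure \<nu>"
    and "integrable \<mu> f" and "integrable \<nu> g"
    and "integrable \<mu> h" and "\<And>x. x \<in> space \<mu> \<Longrightarrow> 0 < h x"
    and "integrable \<nu> k" and "\<And>y. y \<in> space \<nu> \<Longrightarrow> 0 < k y"
    and "\<alpha> = density \<mu> (\<lambda>x. ennreal (h x))"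
    and "\<beta> = density \<nu> (\<lambda>y. ennreal (k y))"
  shows "(\<exists>S. stochastic_operator \<nu> \<mu> S \<and>
            (\<forall>i. AE x in \<mu>. S (\<lambda>y. g y $ i) x = f x $ i) \<and>
            (AE x in \<mu>. S k x = h x))
     \<longleftrightarrow> (\<exists>D. doubly_stochastic_operator \<beta> \<alpha> D \<and>
            (\<forall>i. AE x in \<alpha>. D (\<lambda>y. g y $ i / k y) x = f x $ i / h x))"
proof -
  note \<alpha> = \<open>\<alpha> = density \<mu> (\<lambda>x. ennreal (h x))\<close>
    and \<beta> = \<open>\<beta> = density \<nu> (\<lambda>y. ennreal (k y))\<close>
  note h_pos = \<open>\<And>x. x \<in> space \<mu> \<Longrightarrow> 0 < h x\<close> and k_pos = \<open>\<And>y. y \<in> space \<nu> \<Longrightarrow> 0 < k y\<close>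
  note h_int = \<open>integrable \<mu> h\<close> and k_int = \<open>integrable \<nu> k\<close>
  have h_meas: "h \<in> borel_measurable \<mu>" and k_meas: "k \<in> borel_measurable \<nu>"
    using h_int k_int by auto
  have AE_\<alpha>: "(AE x in \<alpha>. P x) \<longleftrightarrow> (AE x in \<mu>. P x)" for P
    unfolding \<alpha> by (rule AE_density_pos[OF h_meas h_pos])
  have g_int: "integrable \<nu> (\<lambda>y. g y $ i)" for i
    using \<open>integrable \<nu> g\<close> by (rule integrable_bounded_linear[OF bounded_linear_vec_nth])
  show ?thesis (is "?matrix \<longleftrightarrow> ?multivariate")
  proof
    assume ?matrix
    then obtain S where S: "stochastic_operator \<nu> \<mu> S"
      and Sg: "\<And>i. AE x in \<mu>. S (\<lambda>y. g y $ i) x = f x $ i"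
      and Sk: "AE x in \<mu>. S k x = h x"
      by blast
    have Sk_int: "integrable \<mu> (S k)"
      using S k_int by (simp add: stochastic_operator_def L1_linear_operator_def)
    have "(\<integral>x. h x \<partial>\<mu>) = (\<integral>x. S k x \<partial>\<mu>)"
      using Sk h_int Sk_int by (intro integral_cong_AE) auto
    also have "\<dots> = (\<integral>y. k y \<partial>\<nu>)"
      using S k_int by (simp add: stochastic_operator_def)
    finally have mass: "emeasure \<alpha> (space \<alpha>) = emeasure \<beta> (space \<beta>)"
      unfolding \<alpha> \<beta> by (simp add: emeasure_density_space h_int h_pos k_int k_pos)
    have finite: "emeasure \<beta> (space \<beta>) < \<infinity>"
      unfolding \<beta> by (simp add: emeasure_density_space k_int k_pos)
    have "stochastic_operator \<beta> \<alpha> (reweight k h S)"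
      unfolding \<alpha> \<beta> by (rule stochastic_operator_reweight[OF S k_meas k_pos h_meas h_pos])
    moreover have "AE x in \<alpha>. reweight k h S (\<lambda>_. 1) x = 1"
      using Sk AE_space unfolding AE_\<alpha>
      by eventually_elim (simp add: reweight_def h_pos less_imp_neq[symmetric])
    ultimately have "doubly_stochastic_operator \<beta> \<alpha> (reweight k h S)"
      using mass finite by (simp add: doubly_stochastic_operator_def)
    moreover have "AE x in \<alpha>. reweight k h S (\<lambda>y. g y $ i / k y) x = f x $ i / h x" for i
    proof -
      have cancel: "AE y in \<nu>. g y $ i = k y * (g y $ i / k y)"
        using k_pos by (intro AE_I2) (simp add: less_imp_neq[symmetric])
      then have "integrable \<nu> (\<lambda>y. k y * (g y $ i / k y))"
        using g_int[of i] k_meas by (subst integrable_cong_AE[symmetric]) auto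
      then have "AE x in \<mu>. S (\<lambda>y. g y $ i) x = S (\<lambda>y. k y * (g y $ i / k y)) x"
        using cancel by (intro stochastic_operator_cong_AE[OF S g_int])
      with Sg[of i] show ?thesis
        unfolding AE_\<alpha> by eventually_elim (simp add: reweight_def)
    qed
    ultimately show ?multivariate
      by blast
  next
    assume ?multivariate
    then obtain D where D: "doubly_stochastic_operator \<beta> \<alpha> D"
      and Dg: "\<And>i. AE x in \<alpha>. D (\<lambda>y. g y $ i / k y) x = f x $ i / h x"
      by blast
    define S where "S = reweight (\<lambda>y. inverse (k y)) (\<lambda>x. inverse (h x)) D"
    have D_stoch: "stochastic_operator \<beta> \<alpha> D" and D1: "AE x in \<alpha>. D (\<lambda>_. 1) x = 1"
      and finite: "emeasure \<beta> (space \<beta>) < \<infinity>"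
      using D by (simp_all add: doubly_stochastic_operator_def)
    have "stochastic_operator (density \<beta> (\<lambda>y. inverse (k y))) (density \<alpha> (\<lambda>x. inverse (h x))) S"
      unfolding S_def using h_meas k_meas h_pos k_pos
      by (intro stochastic_operator_reweight[OF D_stoch]) (auto simp: \<alpha> \<beta>)
    then have "stochastic_operator \<nu> \<mu> S"
      unfolding \<alpha> \<beta> by (simp only: density_density_inverse[OF h_meas h_pos]
          density_density_inverse[OF k_meas k_pos])
    moreover have "AE x in \<mu>. S (\<lambda>y. g y $ i) x = f x $ i" for i
      using Dg[of i] AE_space unfolding AE_\<alpha>
      by eventually_elim (simp add: S_def reweight_def divide_inverse mult.commute
          h_pos less_imp_neq[symmetric])
    moreover have "AE x in \<mu>. S k x = h x"
    proof -
      \<comment> \<open>Outside the space \<open>k\<close> may vanish, so \<open>k / k\<close> is only almost everywhere the constant 1.\<close>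
      have one: "AE y in \<beta>. inverse (k y) * k y = 1"
        unfolding \<beta> using k_pos by (intro AE_I2) (simp add: less_imp_neq[symmetric])
      have int1: "integrable \<beta> (\<lambda>_. 1 :: real)"
        using finite by (simp add: integrable_iff_bounded)
      also have "?this \<longleftrightarrow> integrable \<beta> (\<lambda>y. inverse (k y) * k y)"
        using k_pos by (intro Bochner_Integration.integrable_cong)
          (simp_all add: \<beta> less_imp_neq[symmetric])
      finally have "AE x in \<alpha>. D (\<lambda>y. inverse (k y) * k y) x = D (\<lambda>_. 1) x"
        using one int1 by (intro stochastic_operator_cong_AE[OF D_stoch])
      with D1 show ?thesis
        using AE_space unfolding AE_\<alpha> by eventually_elim (simp add: S_def reweight_def divide_inverse)
    qed
    ultimately show ?matrix
      by blast
  qed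
qed

end
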